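(* Let $x^*\in C^1([0,L],\mathbb R^n)$ and $f^*\in C^1([0,L],\mathbb R)$, let $Q\in\mathbb R^{n\times n}$ be positive definite with $\|Q\|$ bounded and $Q\ge\delta I$ for a known real $\delta>0$, and let $x_k(0)=z_k(0)=0$ for all $k$. Given $\lambda$ and $\rho\in(0,1)$, there exists $\omega_0\in(0,+\infty)$ such that for every $\omega\in(\omega_0,\infty)$ the operator $H_k$ maps $S=\{y\in\mathcal X:\|y\|_\lambda\le D_2\}$ into $S$, if $D_2$ satisfies $$D_2\ge\max\{D_0,D^\star\},$$ where $$D^\star=\frac{\rho}{1-\rho}\left(D_1+\frac{\beta}{1-\beta}\|x^*\|_\lambda\right),$$ $D_1$ is the uniform bound of $\|x_k-z_k\|_\lambda$ for an arbitrary $k$ (that is, $\|x_k-z_k\|_\lambda\le D_1$ for every $k$), and $D_0=\|y_1\|_\lambda$ with $y_1$ the solution on $[0,L]$ of $y_1(t)=-x^*(t)-\Gamma_1\int_0^ty_1(s)\,ds$.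
   Context: $L>0$, $\alpha\in(0,\infty)$, $\beta\in(0,1)$ is the forgetting factor, $k\in\{1,2,\dots\}$ is the iteration index. $\mathcal X=C([0,L],\mathbb R^n)$ with the $\lambda$-norm ($\lambda>0$) $\|f\|_\lambda=\max_{t\in[0,L]}e^{-\lambda t}\|f(t)\|_\infty$, where $\|\cdot\|_\infty$ is the max norm on $\mathbb R^n$. Cost function: $F(x,t)=f^*(t)+[x-x^*(t)]^TQ[x-x^*(t)]$ for $x\in\mathbb R^n$, $t\in[0,L]$. Iterative learning extremum seeking system (original system), with dither frequency $\omega>0$, $x_k(t)\in\mathbb R^n$: $x_0\equiv0$, $\dot x_0\equiv 0$, and for $k\ge1$, on $[0,L]$, $$\dot x_k(t)=(1-\beta)\dot x_{k-1}(t)-\alpha F(x_k(t),t)\sqrt\omega\sin(\omega t)+\sqrt\omega\cos(\omega t).$$ Modified Lie bracket (MLB) system: $z_0\equiv0$, and for $k\ge1$, on $[0,L]$, $$\dot z_k=(1-\beta)\dot x_{k-1}-\frac{\alpha\gamma_k}{2}\nabla_zF(z_k,t),\qquad \gamma_k=\frac{1-(1-\beta)^k}{\beta}.$$ With $\Gamma_k=\dfrac{\alpha\gamma_kQ}{2}$, define for $x\in\mathcal X$ $$T_k(x)(t)=(1-\beta)x(t)-(1-\beta)e^{-\Gamma_kt}\int_0^te^{\Gamma_ks}\Gamma_kx(s)\,ds,$$ $$H_k(x)=T_k(x)+T_k\!\left(-\frac{\beta}{1-\beta}x^*\right)+T_k(x_{k-1}-z_{k-1}).$$ The number $\rho$ is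 a contraction ratio common to all $T_k$: $\|T_k(x)-T_k(y)\|_\lambda\le\rho\|x-y\|_\lambda$ for all $x,y\in\mathcal X$ and all $k$. The operator $H_k$ is the right-hand side of the recursion $y_k=T_k(y_{k-1})+T_k(x_{k-1}-z_{k-1})+T_k\left(-\frac{\beta}{1-\beta}x^*\right)$ by which the paper describes the tracking error $y_k=z_k-x^*$ of the MLB system. *)

theory Defs
  imports "HOL-Analysis.Analysis"
begin

text \<open>
  Elements of \<open>C([0,L], \<real>\<^sup>n)\<close> are total functions \<open>real \<Rightarrow> real ^ 'n\<close> that are continuous on
  \<open>{0..L}\<close>; their values outside \<open>{0..L}\<close> are irrelevant to every notion below.
\<close>

definition C_space :: "real \<Rightarrow> (real \<Rightarrow> real ^ 'n) set" where
  "C_space L = {f. continuous_on {0..L} f}"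

text \<open>
  The supremum is the maximum for \<open>f \<in> C_space L\<close>; \<^const>\<open>infnorm\<close> is the max norm on \<open>\<real>\<^sup>n\<close>.
\<close>

definition lam_norm :: "real \<Rightarrow> real \<Rightarrow> (real \<Rightarrow> real ^ 'n) \<Rightarrow> real" where
  "lam_norm L lam f = (SUP t\<in>{0..L}. exp (- lam * t) * infnorm (f t))"

definition lam_ball :: "real \<Rightarrow> real \<Rightarrow> real \<Rightarrow> (real \<Rightarrow> real ^ 'n) set" where
  "lam_ball L lam D = {y \<in> C_space L. lam_norm L lam y \<le> D}"

text \<open>
  One-sided derivatives at the endpoints. The library's \<^const>\<open>C1_differentiable_on\<close> would ask for
  two-sided ones, and so constrain values outside \<open>{0..L}\<close>.
\<close>

definition C1_interval :: "real \<Rightarrow> (real \<Rightarrow> 'a::real_normed_vector) \<Rightarrow> bool" where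
  "C1_interval L f \<longleftrightarrow>
     (\<exists>f'. continuous_on {0..L} f' \<and>
           (\<forall>t\<in>{0..L}. (f has_vector_derivative f' t) (at t within {0..L})))"

text \<open>Symmetry is not part of these two notions.\<close>

definition pos_definite :: "real ^ 'n ^ 'n \<Rightarrow> bool" where
  "pos_definite A \<longleftrightarrow> (\<forall>v. v \<noteq> 0 \<longrightarrow> 0 < v \<bullet> (A *v v))"

definition mat_ge :: "real ^ 'n ^ 'n \<Rightarrow> real ^ 'n ^ 'n \<Rightarrow> bool" where
  "mat_ge A B \<longleftrightarrow> (\<forall>v. v \<bullet> (B *v v) \<le> v \<bullet> (A *v v))"

text \<open>
  The multiplication \<open>*\<close> that the library puts on \<open>real ^ 'n ^ 'n\<close> is componentwise, so the powers
  are formed with the matrix product \<open>**\<close>.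
\<close>

definition mat_exp :: "real ^ 'n ^ 'n \<Rightarrow> real ^ 'n ^ 'n" where
  "mat_exp A = (\<Sum>j. (1 / fact j) *\<^sub>R (((**) A ^^ j) (mat 1)))"

definition gradient :: "('a::real_inner \<Rightarrow> real) \<Rightarrow> 'a \<Rightarrow> 'a" where
  "gradient g u = (THE D. GDERIV g u :> D)"

definition cost ::
  "real ^ 'n ^ 'n \<Rightarrow> (real \<Rightarrow> real ^ 'n) \<Rightarrow> (real \<Rightarrow> real) \<Rightarrow> real ^ 'n \<Rightarrow> real \<Rightarrow> real" where
  "cost Q xs fs u t = fs t + (u - xs t) \<bullet> (Q *v (u - xs t))"

definition gam :: "real \<Rightarrow> nat \<Rightarrow> real" where
  "gam \<beta> k = (1 - (1 - \<beta>) ^ k) / \<beta>"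

definition Gam :: "real \<Rightarrow> real \<Rightarrow> real ^ 'n ^ 'n \<Rightarrow> nat \<Rightarrow> real ^ 'n ^ 'n" where
  "Gam \<alpha> \<beta> Q k = (\<alpha> * gam \<beta> k / 2) *\<^sub>R Q"

abbreviation deriv_on :: "real \<Rightarrow> (real \<Rightarrow> real ^ 'n) \<Rightarrow> real \<Rightarrow> real ^ 'n" where
  "deriv_on L f t \<equiv> vector_derivative f (at t within {0..L})"

text \<open>
  The dither and feedback terms are scalars; they act identically on all components, whence
  \<^const>\<open>vec\<close>.
\<close>

definition original_system ::
  "real \<Rightarrow> real \<Rightarrow> real \<Rightarrow> (real ^ 'n \<Rightarrow> real \<Rightarrow> real) \<Rightarrow> real
   \<Rightarrow> (nat \<Rightarrow> real \<Rightarrow> real ^ 'n) \<Rightarrow> bool" where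
  "original_system L \<alpha> \<beta> F \<omega> x \<longleftrightarrow>
     (\<forall>t\<in>{0..L}. x 0 t = 0) \<and>
     (\<forall>k\<ge>1. \<forall>t\<in>{0..L}.
        (x k has_vector_derivative
           (1 - \<beta>) *\<^sub>R deriv_on L (x (k - 1)) t
           + vec (- \<alpha> * F (x k t) t * sqrt \<omega> * sin (\<omega> * t) + sqrt \<omega> * cos (\<omega> * t)))
        (at t within {0..L}))"

definition MLB_system ::
  "real \<Rightarrow> real \<Rightarrow> real \<Rightarrow> (real ^ 'n \<Rightarrow> real \<Rightarrow> real)
   \<Rightarrow> (nat \<Rightarrow> real \<Rightarrow> real ^ 'n) \<Rightarrow> (nat \<Rightarrow> real \<Rightarrow> real ^ 'n) \<Rightarrow> bool" where
  "MLB_system L \<alpha> \<beta> F x z \<longleftrightarrow>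
     (\<forall>t\<in>{0..L}. z 0 t = 0) \<and>
     (\<forall>k\<ge>1. \<forall>t\<in>{0..L}.
        (z k has_vector_derivative
           (1 - \<beta>) *\<^sub>R deriv_on L (x (k - 1)) t
           - (\<alpha> * gam \<beta> k / 2) *\<^sub>R gradient (\<lambda>u. F u t) (z k t))
        (at t within {0..L}))"

definition T_op ::
  "real \<Rightarrow> real \<Rightarrow> real ^ 'n ^ 'n \<Rightarrow> nat \<Rightarrow> (real \<Rightarrow> real ^ 'n) \<Rightarrow> real \<Rightarrow> real ^ 'n" where
  "T_op \<alpha> \<beta> Q k f t =
     (1 - \<beta>) *\<^sub>R f t
     - (1 - \<beta>) *\<^sub>R (mat_exp (- (t *\<^sub>R Gam \<alpha> \<beta> Q k)) *v
         integral {0..t} (\<lambda>s. mat_exp (s *\<^sub>R Gam \<alpha> \<beta> Q k) *v (Gam \<alpha> \<beta> Q k *v f s)))"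

definition H_op ::
  "real \<Rightarrow> real \<Rightarrow> real ^ 'n ^ 'n \<Rightarrow> (real \<Rightarrow> real ^ 'n)
   \<Rightarrow> (nat \<Rightarrow> real \<Rightarrow> real ^ 'n) \<Rightarrow> (nat \<Rightarrow> real \<Rightarrow> real ^ 'n)
   \<Rightarrow> nat \<Rightarrow> (real \<Rightarrow> real ^ 'n) \<Rightarrow> real \<Rightarrow> real ^ 'n" where
  "H_op \<alpha> \<beta> Q xs x z k y t =
     T_op \<alpha> \<beta> Q k y t
     + T_op \<alpha> \<beta> Q k (\<lambda>s. (- (\<beta> / (1 - \<beta>))) *\<^sub>R xs s) t
     + T_op \<alpha> \<beta> Q k (\<lambda>s. x (k - 1) s - z (k - 1) s) t"

end

theory Submission
  imports Defs
begin

text \<open>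
  The claim is a norm estimate. Each \<open>T_k\<close> sends \<open>0\<close> to \<open>0\<close>, so the contraction
  hypothesis turns into \<open>\<parallel>T_k f\<parallel> \<le> \<rho> \<parallel>f\<parallel>\<close>, and the triangle inequality gives
  \<open>\<parallel>H_k y\<parallel> \<le> \<rho> (D2 + \<beta> / (1 - \<beta>) \<parallel>xs\<parallel> + D1)\<close> for \<open>\<parallel>y\<parallel> \<le> D2\<close>. The right-hand side is at most \<open>D2\<close>
  exactly when \<open>D2\<close> is at least the threshold \<open>\<rho> / (1 - \<rho>) * (D1 + \<beta> / (1 - \<beta>) \<parallel>xs\<parallel>)\<close>.

  Once \<open>D1\<close> bounds \<open>x_k - z_k\<close>, this estimate is uniform in the dither frequency, so any positive \<open>\<omega>0\<close>
  serves as a witness.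

  What remains is to stay inside \<open>C([0,L])\<close>, where the supremum defining the norm is one of a
  bounded set and where the contraction hypothesis applies. The trajectories are continuous because
  they are differentiable (\<open>trajectory_difference_in_C_space\<close>), and \<open>T_k f\<close> is continuous because
  \<open>t \<mapsto> mat_exp (t A)\<close> is (\<open>continuous_on_mat_exp_scaleR\<close>), a locally uniform limit of its partial sums.
\<close>

section \<open>The weighted supremum norm\<close>

lemma weighted_infnorm_bdd_above:
  assumes "f \<in> C_space L"
  shows "bdd_above ((\<lambda>t. exp (- lam * t) * infnorm (f t)) ` {0..L})"
proof -
  have "continuous_on {0..L} (\<lambda>t. exp (- lam * t) * infnorm (f t))"
    using assms unfolding C_space_def by (auto intro!: continuous_intros)
  then show ?thesis
    by (intro bounded_imp_bdd_above compact_imp_bounded compact_continuous_image compact_Icc)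
qed

lemma lam_norm_upper:
  assumes "f \<in> C_space L" "t \<in> {0..L}"
  shows "exp (- lam * t) * infnorm (f t) \<le> lam_norm L lam f"
  unfolding lam_norm_def using weighted_infnorm_bdd_above[OF assms(1)] assms(2) by (rule cSUP_upper2) simp

lemma lam_norm_least:
  assumes "0 \<le> L" "\<And>t. t \<in> {0..L} \<Longrightarrow> exp (- lam * t) * infnorm (f t) \<le> M"
  shows "lam_norm L lam f \<le> M"
  unfolding lam_norm_def using assms by (intro cSUP_least) auto

lemma lam_norm_nonneg:
  assumes "0 \<le> L" "f \<in> C_space L"
  shows "0 \<le> lam_norm L lam f"
proof -
  have "0 \<le> exp (- lam * 0) * infnorm (f 0)"
    by (simp add: infnorm_pos_le)
  also have "\<dots> \<le> lam_norm L lam f"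
    using assms by (intro lam_norm_upper) auto
  finally show ?thesis .
qed

lemma lam_norm_triangle:
  assumes "0 \<le> L" "f \<in> C_space L" "g \<in> C_space L"
  shows "lam_norm L lam (\<lambda>t. f t + g t) \<le> lam_norm L lam f + lam_norm L lam g"
proof (rule lam_norm_least[OF assms(1)])
  fix t assume t: "t \<in> {0..L}"
  have "exp (- lam * t) * infnorm (f t + g t)
      \<le> exp (- lam * t) * infnorm (f t) + exp (- lam * t) * infnorm (g t)"
    using infnorm_triangle[of "f t" "g t"] by (simp flip: distrib_left)
  also have "\<dots> \<le> lam_norm L lam f + lam_norm L lam g"
    using lam_norm_upper[OF assms(2) t, of lam] lam_norm_upper[OF assms(3) t, of lam] by simp
  finally show "exp (- lam * t) * infnorm (f t + g t) \<le> lam_norm L lam f + lam_norm L lam g" .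
qed

lemma lam_norm_scaleR_le:
  assumes "0 \<le> L" "f \<in> C_space L"
  shows "lam_norm L lam (\<lambda>t. c *\<^sub>R f t) \<le> \<bar>c\<bar> * lam_norm L lam f"
proof (rule lam_norm_least[OF assms(1)])
  fix t assume t: "t \<in> {0..L}"
  show "exp (- lam * t) * infnorm (c *\<^sub>R f t) \<le> \<bar>c\<bar> * lam_norm L lam f"
    using mult_left_mono[OF lam_norm_upper[OF assms(2) t, of lam], of "\<bar>c\<bar>"]
    by (simp add: infnorm_mul mult.left_commute)
qed

lemma C_space_add:
  "f \<in> C_space L \<Longrightarrow> g \<in> C_space L \<Longrightarrow> (\<lambda>t. f t + g t) \<in> C_space L"
  unfolding C_space_def by (auto intro!: continuous_intros)

lemma C_space_scaleR:
  "f \<in> C_space L \<Longrightarrow> (\<lambda>t. c *\<^sub>R f t) \<in> C_space L"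
  unfolding C_space_def by (auto intro!: continuous_intros)

section \<open>Continuity of the matrix exponential along a line\<close>

lemma matrix_mult_scaleR_left: "(c *\<^sub>R A) ** B = c *\<^sub>R (A ** B)"
  for A :: "real ^ 'n ^ 'm" and B :: "real ^ 'p ^ 'n"
  by (simp add: vec_eq_iff matrix_matrix_mult_def sum_distrib_left mult.assoc)

lemma matrix_mult_scaleR_right: "A ** (c *\<^sub>R B) = c *\<^sub>R (A ** B)"
  for A :: "real ^ 'n ^ 'm" and B :: "real ^ 'p ^ 'n"
  by (simp add: vec_eq_iff matrix_matrix_mult_def sum_distrib_left mult.left_commute)

lemma bounded_linear_matrix_mult_left:
  "bounded_linear ((**) A :: real ^ 'p ^ 'n \<Rightarrow> real ^ 'p ^ 'm)"
  by (intro linear_conv_bounded_linear[THEN iffD1] linearI)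
    (simp_all add: matrix_add_ldistrib matrix_mult_scaleR_right)

lemma bounded_bilinear_matrix_vector_mult:
  "bounded_bilinear ((*v) :: real ^ 'n ^ 'n \<Rightarrow> real ^ 'n \<Rightarrow> real ^ 'n)"
  by (auto simp: bilinear_conv_bounded_bilinear[symmetric] bilinear_def
      matrix_vector_mult_add_rdistrib matrix_vector_right_distrib
      scaleR_matrix_vector_assoc matrix_vector_mult_scaleR intro!: linearI)

lemma matrix_power_scaleR:
  "((**) (t *\<^sub>R A) ^^ j) (mat 1) = t ^ j *\<^sub>R ((**) A ^^ j) (mat 1)"
  for A :: "real ^ 'n ^ 'n"
  by (induction j) (simp_all add: matrix_mult_scaleR_left matrix_mult_scaleR_right)

text \<open>
  The powers are iterates of the bounded linear map \<open>(**) A\<close>, whose operator norm gives their geometric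
  growth without any submultiplicativity of the matrix norm itself.
\<close>

lemma norm_matrix_power_le:
  "norm (((**) A ^^ j) (mat 1))
    \<le> onorm ((**) A :: real ^ 'n ^ 'n \<Rightarrow> real ^ 'n ^ 'n) ^ j * norm (mat 1 :: real ^ 'n ^ 'n)"
    (is "_ \<le> ?c ^ j * _")
  for A :: "real ^ 'n ^ 'n"
proof (induction j)
  case 0
  then show ?case by simp
next
  case (Suc j)
  have "norm (((**) A ^^ Suc j) (mat 1)) \<le> ?c * norm (((**) A ^^ j) (mat 1))"
    using onorm[OF bounded_linear_matrix_mult_left[of A]] by simp
  also have "\<dots> \<le> ?c * (?c ^ j * norm (mat 1 :: real ^ 'n ^ 'n))"
    by (intro mult_left_mono Suc onorm_pos_le bounded_linear_matrix_mult_left)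
  finally show ?case by (simp add: mult.assoc)
qed

text \<open>
  On \<open>[-R, R]\<close> the terms of the series are dominated by those of \<open>exp (R * onorm ((**) A))\<close>, so the
  Weierstrass test makes the convergence uniform there.
\<close>

lemma continuous_on_mat_exp_scaleR:
  fixes A :: "real ^ 'n ^ 'n"
  shows "continuous_on {-R..R} (\<lambda>t. mat_exp (t *\<^sub>R A))"
proof -
  let ?c = "onorm ((**) A :: real ^ 'n ^ 'n \<Rightarrow> real ^ 'n ^ 'n)"
  define M where "M j = inverse (fact j) * (R * ?c) ^ j * norm (mat 1 :: real ^ 'n ^ 'n)"
    for j :: nat
  have "summable M"
    unfolding M_def by (intro summable_mult2 summable_exp)
  have "norm ((1 / fact j) *\<^sub>R ((**) (t *\<^sub>R A) ^^ j) (mat 1)) \<le> M j"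
    if "t \<in> {-R..R}" for j t
  proof -
    have "\<bar>t\<bar> ^ j * norm (((**) A ^^ j) (mat 1))
        \<le> R ^ j * (?c ^ j * norm (mat 1 :: real ^ 'n ^ 'n))"
      using that by (intro mult_mono power_mono norm_matrix_power_le) auto
    then show ?thesis
      unfolding M_def matrix_power_scaleR
      by (simp add: power_abs power_mult_distrib divide_simps mult_ac)
  qed
  then have "uniform_limit {-R..R}
      (\<lambda>n t. \<Sum>j<n. (1 / fact j) *\<^sub>R ((**) (t *\<^sub>R A) ^^ j) (mat 1)) (\<lambda>t. mat_exp (t *\<^sub>R A)) sequentially"
    unfolding mat_exp_def using \<open>summable M\<close> by (intro Weierstrass_m_test)
  then show ?thesis
    by (rule uniform_limit_theorem[rotated])
      (auto simp: matrix_power_scaleR intro!: always_eventually continuous_intros)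
qed

section \<open>The operators on the space of continuous functions\<close>

lemma T_op_in_C_space:
  assumes "f \<in> C_space L"
  shows "T_op \<alpha> \<beta> Q k f \<in> C_space L"
proof -
  let ?A = "Gam \<alpha> \<beta> Q k"
  note mult_cont = bounded_bilinear.continuous_on[OF bounded_bilinear_matrix_vector_mult]
  have f: "continuous_on {0..L} f"
    using assms by (simp add: C_space_def)
  have "continuous_on {-L..L} (\<lambda>t. mat_exp (t *\<^sub>R ?A))"
    by (rule continuous_on_mat_exp_scaleR)
  then have exp: "continuous_on {0..L} (\<lambda>t. mat_exp (t *\<^sub>R ?A))"
    by (rule continuous_on_subset) auto
  have "continuous_on {0..L} (\<lambda>t. mat_exp ((- t) *\<^sub>R ?A))"
    by (rule continuous_on_compose2[OF continuous_on_mat_exp_scaleR[of L]])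
      (auto intro!: continuous_intros)
  then have exp_neg: "continuous_on {0..L} (\<lambda>t. mat_exp (- (t *\<^sub>R ?A)))"
    by simp
  have "continuous_on {0..L} (\<lambda>s. mat_exp (s *\<^sub>R ?A) *v (?A *v f s))"
    by (intro mult_cont exp f continuous_on_const)
  then have "continuous_on {0..L} (\<lambda>t. integral {0..t} (\<lambda>s. mat_exp (s *\<^sub>R ?A) *v (?A *v f s)))"
    by (intro indefinite_integral_continuous_1 integrable_continuous_real)
  then show ?thesis
    unfolding C_space_def T_op_def mem_Collect_eq
    by (intro continuous_intros mult_cont exp_neg f)
qed

lemma T_op_zero: "T_op \<alpha> \<beta> Q k (\<lambda>t. 0) = (\<lambda>t. 0)"
  by (simp add: T_op_def fun_eq_iff)

lemma H_op_eq_sum: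
  "H_op \<alpha> \<beta> Q xs x z k y =
    (\<lambda>t. (T_op \<alpha> \<beta> Q k y t + T_op \<alpha> \<beta> Q k (\<lambda>s. (- (\<beta> / (1 - \<beta>))) *\<^sub>R xs s) t)
      + T_op \<alpha> \<beta> Q k (\<lambda>s. x (k - 1) s - z (k - 1) s) t)"
  by (simp add: H_op_def fun_eq_iff)

section \<open>Regularity of the trajectories\<close>

lemma original_system_in_C_space:
  assumes "original_system L \<alpha> \<beta> F \<omega> x"
  shows "x k \<in> C_space L"
proof (cases "k = 0")
  case True
  then have "continuous_on {0..L} (x k) \<longleftrightarrow> continuous_on {0..L} (\<lambda>_. 0 :: real ^ 'a)"
    using assms by (intro continuous_on_cong) (auto simp: original_system_def)
  then show ?thesis
    by (simp add: C_space_def)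
next
  case False
  then show ?thesis
    using assms unfolding original_system_def C_space_def
    by (auto simp: Suc_le_eq continuous_on_eq_continuous_within
        intro!: has_vector_derivative_continuous)
qed

lemma MLB_system_in_C_space:
  assumes "MLB_system L \<alpha> \<beta> F x z"
  shows "z k \<in> C_space L"
proof (cases "k = 0")
  case True
  then have "continuous_on {0..L} (z k) \<longleftrightarrow> continuous_on {0..L} (\<lambda>_. 0 :: real ^ 'a)"
    using assms by (intro continuous_on_cong) (auto simp: MLB_system_def)
  then show ?thesis
    by (simp add: C_space_def)
next
  case False
  then show ?thesis
    using assms unfolding MLB_system_def C_space_def
    by (auto simp: Suc_le_eq continuous_on_eq_continuous_within
        intro!: has_vector_derivative_continuous)
qed

lemma trajectory_difference_in_C_space:
  assumes "original_system L \<alpha> \<beta> F \<omega> x" "MLB_system L \<alpha> \<beta> F x z"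
  shows "(\<lambda>t. x k t - z k t) \<in> C_space L"
  using original_system_in_C_space[OF assms(1), of k] MLB_system_in_C_space[OF assms(2), of k]
  unfolding C_space_def by (auto intro!: continuous_intros)

section \<open>The invariant ball\<close>

theorem theoremV3:
  fixes L \<alpha> \<beta> \<delta> qbar lam \<rho> :: real
    and Q :: "real ^ 'n ^ 'n"
    and xs y1 :: "real \<Rightarrow> real ^ 'n"
    and fs :: "real \<Rightarrow> real"
  assumes "L > 0" and "\<alpha> > 0" and "0 < \<beta>" and "\<beta> < 1"
    and "C1_interval L xs" and "C1_interval L fs"
    and "pos_definite Q" and "onorm ((*v) Q) \<le> qbar"
    and "\<delta> > 0" and "mat_ge Q (\<delta> *\<^sub>R mat 1)"
    and "lam > 0" and "0 < \<rho>" and "\<rho> < 1"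
    and contraction: "\<And>k f g. k \<ge> 1 \<Longrightarrow> f \<in> C_space L \<Longrightarrow> g \<in> C_space L \<Longrightarrow>
          lam_norm L lam (\<lambda>t. T_op \<alpha> \<beta> Q k f t - T_op \<alpha> \<beta> Q k g t)
            \<le> \<rho> * lam_norm L lam (\<lambda>t. f t - g t)"
    and y1_cont: "y1 \<in> C_space L"
    and y1_eq: "\<And>t. t \<in> {0..L} \<Longrightarrow> y1 t = - xs t - Gam \<alpha> \<beta> Q 1 *v integral {0..t} y1"
  shows "\<exists>\<omega>0>0. \<forall>\<omega>>\<omega>0. \<forall>x z.
           original_system L \<alpha> \<beta> (cost Q xs fs) \<omega> x \<and>
           MLB_system L \<alpha> \<beta> (cost Q xs fs) x z \<and>
           (\<forall>k. x k 0 = 0 \<and> z k 0 = 0) \<longrightarrow>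
           (\<forall>D1 D2.
              (\<forall>k\<ge>1. lam_norm L lam (\<lambda>t. x k t - z k t) \<le> D1) \<and>
              D2 \<ge> max (lam_norm L lam y1)
                       (\<rho> / (1 - \<rho>) * (D1 + \<beta> / (1 - \<beta>) * lam_norm L lam xs)) \<longrightarrow>
              (\<forall>k\<ge>1. H_op \<alpha> \<beta> Q xs x z k ` lam_ball L lam D2 \<subseteq> lam_ball L lam D2))"
proof -
  have T_bound: "lam_norm L lam (T_op \<alpha> \<beta> Q k f) \<le> \<rho> * lam_norm L lam f"
    if "k \<ge> 1" "f \<in> C_space L" for k f
    using contraction[OF that, of "\<lambda>_. 0"] by (simp add: T_op_zero C_space_def)
  have "C1_interval L xs" by fact
  then have xs: "xs \<in> C_space L"
    unfolding C1_interval_def C_space_def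
    by (auto simp: continuous_on_eq_continuous_within intro: has_vector_derivative_continuous)
  have main: "H_op \<alpha> \<beta> Q xs x z k y \<in> lam_ball L lam D2"
    if sys: "original_system L \<alpha> \<beta> (cost Q xs fs) \<omega> x" "MLB_system L \<alpha> \<beta> (cost Q xs fs) x z"
      and D1: "\<forall>k\<ge>1. lam_norm L lam (\<lambda>t. x k t - z k t) \<le> D1"
      and D2: "\<rho> / (1 - \<rho>) * (D1 + \<beta> / (1 - \<beta>) * lam_norm L lam xs) \<le> D2"
      and k: "k \<ge> 1" and y: "y \<in> lam_ball L lam D2"
    for \<omega> x z D1 D2 k y
  proof -
    let ?e = "\<lambda>t. x (k - 1) t - z (k - 1) t"
    let ?w = "\<lambda>t. (- (\<beta> / (1 - \<beta>))) *\<^sub>R xs t"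
    have yC: "y \<in> C_space L" and y_le: "lam_norm L lam y \<le> D2"
      using y by (auto simp: lam_ball_def)
    have eC: "?e \<in> C_space L"
      using sys by (rule trajectory_difference_in_C_space)
    have wC: "?w \<in> C_space L"
      using xs by (rule C_space_scaleR)
    \<comment> \<open>\<open>D1\<close> bounds the difference only from iteration \<open>1\<close> on; for \<open>k = 1\<close> the operator uses
      iteration \<open>0\<close>, where the difference vanishes, and \<open>D1\<close> is nonnegative since it bounds a norm.\<close>
    have e_le: "lam_norm L lam ?e \<le> D1"
    proof (cases "k = 1")
      case True
      have "0 \<le> lam_norm L lam (\<lambda>t. x 1 t - z 1 t)"
        using \<open>L > 0\<close> by (intro lam_norm_nonneg trajectory_difference_in_C_space[OF sys]) simp
      also have "\<dots> \<le> D1"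
        using D1 by simp
      finally have "0 \<le> D1" .
      then show ?thesis
        using \<open>L > 0\<close> sys True
        by (intro lam_norm_least) (auto simp: original_system_def MLB_system_def infnorm_0)
    next
      case False
      then show ?thesis using D1 k by simp
    qed
    have w_le: "lam_norm L lam ?w \<le> \<beta> / (1 - \<beta>) * lam_norm L lam xs"
      using lam_norm_scaleR_le[OF _ xs, of lam "- (\<beta> / (1 - \<beta>))"] \<open>L > 0\<close> \<open>0 < \<beta>\<close> \<open>\<beta> < 1\<close> by simp
    note TC = T_op_in_C_space[OF yC, of \<alpha> \<beta> Q k] T_op_in_C_space[OF wC, of \<alpha> \<beta> Q k]
      T_op_in_C_space[OF eC, of \<alpha> \<beta> Q k]
    have "lam_norm L lam (H_op \<alpha> \<beta> Q xs x z k y)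
        \<le> lam_norm L lam (T_op \<alpha> \<beta> Q k y) + lam_norm L lam (T_op \<alpha> \<beta> Q k ?w)
          + lam_norm L lam (T_op \<alpha> \<beta> Q k ?e)"
      unfolding H_op_eq_sum
      using lam_norm_triangle[OF _ C_space_add[OF TC(1,2)] TC(3), of lam]
        lam_norm_triangle[OF _ TC(1,2), of lam] \<open>L > 0\<close> by linarith
    also have "\<dots> \<le> \<rho> * lam_norm L lam y + \<rho> * lam_norm L lam ?w + \<rho> * lam_norm L lam ?e"
      by (intro add_mono T_bound k yC wC eC)
    also have "\<dots> \<le> \<rho> * D2 + \<rho> * (\<beta> / (1 - \<beta>) * lam_norm L lam xs) + \<rho> * D1"
      using y_le w_le e_le \<open>0 < \<rho>\<close> by (intro add_mono mult_left_mono) auto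
    also have "\<dots> \<le> D2"
    proof -
      have "\<rho> * (D1 + \<beta> / (1 - \<beta>) * lam_norm L lam xs) \<le> D2 * (1 - \<rho>)"
        using D2 \<open>\<rho> < 1\<close> by (simp add: pos_divide_le_eq)
      then show ?thesis by (simp add: distrib_left right_diff_distrib mult.commute)
    qed
    finally have "lam_norm L lam (H_op \<alpha> \<beta> Q xs x z k y) \<le> D2" .
    moreover have "H_op \<alpha> \<beta> Q xs x z k y \<in> C_space L"
      unfolding H_op_eq_sum by (intro C_space_add TC)
    ultimately show ?thesis by (simp add: lam_ball_def)
  qed
  show ?thesis
    by (rule exI[of _ 1]) (auto intro!: main simp del: times_divide_eq_right times_divide_eq_left)
qed

end
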